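(* Let $N\ge 2$, $0<s<1$, and let $f:\mathbb{R}\to\mathbb{R}$ be continuous at $0$. Let $0<\beta<1$ and let $u\in C^{2s+\beta}(\mathbb{R}^N_+)$ be a bounded, nonnegative, classical solution of $$(-\Delta)^s u = f(u)\ \text{ in } \mathbb{R}^N_+,\qquad u=0\ \text{ in } \mathbb{R}^N\setminus\mathbb{R}^N_+ .$$ Suppose that for some $\lambda>0$ the function $u$ is symmetric with respect to the hyperplane $\{x_N=\lambda\}$ in the strip $\Sigma_{2\lambda}=\{x\in\mathbb{R}^N: 0<x_N<2\lambda\}$, that is, $$u(x',2\lambda-x_N)=u(x',x_N)\quad\text{for all } x=(x',x_N)\in\Sigma_{2\lambda}.$$ Then $f(0)=0$ and $u\equiv 0$ in $\mathbb{R}^N$.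
   Context: Notation: $x=(x',x_N)\in\mathbb{R}^{N-1}\times\mathbb{R}$ and $\mathbb{R}^N_+=\{x\in\mathbb{R}^N: x_N>0\}$. The fractional Laplacian is $(-\Delta)^s u(x)=\mathrm{P.V.}\int_{\mathbb{R}^N}\frac{u(x)-u(y)}{|x-y|^{N+2s}}\,dy$ (normalization constant omitted), equivalently, for bounded, sufficiently smooth functions, $(-\Delta)^s u(x)=\frac12\int_{\mathbb{R}^N}\frac{2u(x)-u(x+y)-u(x-y)}{|y|^{N+2s}}\,dy$. A bounded classical solution is a bounded function $u:\mathbb{R}^N\to\mathbb{R}$, continuous in $\mathbb{R}^N$, of class $C^{2s+\beta}$ (locally) in $\mathbb{R}^N_+$, satisfying the equation pointwise in $\mathbb{R}^N_+$ and vanishing in $\mathbb{R}^N\setminus\mathbb{R}^N_+$. *)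

theory Defs
  imports "HOL-Analysis.Analysis"
begin

(* R^N is rendered as (real^'m) \<times> real, with x = (x', x_N), so that
   N = DIM((real^'m) \<times> real) = CARD('m) + 1 ranges over exactly the integers N \<ge> 2. *)

definition upper_half_space :: "((real^'m::finite) \<times> real) set" where
  "upper_half_space = {x. 0 < snd x}"

definition strip :: "real \<Rightarrow> ((real^'m::finite) \<times> real) set" where
  "strip h = {x. 0 < snd x \<and> snd x < h}"

(* P.V. \<integral> (u x - u y) / |x - y|^(N + 2s) dy exists and equals L.  A relation rather than a
   function, so that the existence of the principal value is part of the assertion.
   Integrability off each ball is required explicitly because the Bochner integral
   of a non-integrable function is 0. *)
definition has_fractional_laplacian ::
    "real \<Rightarrow> ('a::euclidean_space \<Rightarrow> real) \<Rightarrow> 'a \<Rightarrow> real \<Rightarrow> bool" where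
  "has_fractional_laplacian s u x L \<longleftrightarrow>
     (\<forall>\<epsilon>>0. set_integrable lebesgue (- ball x \<epsilon>)
        (\<lambda>y. (u x - u y) / norm (x - y) powr (real DIM('a) + 2 * s))) \<and>
     ((\<lambda>\<epsilon>. LINT y:- ball x \<epsilon>|lebesgue.
        (u x - u y) / norm (x - y) powr (real DIM('a) + 2 * s)) \<longlongrightarrow> L) (at_right 0)"

(* Local Hoelder class C^{k,\<gamma>}_loc(S), S open.  For \<gamma> = 0 the Hoelder bound is local
   boundedness, which follows from continuity, so C^{k,0}_loc is the usual C^k. *)
primrec holder_loc ::
    "nat \<Rightarrow> real \<Rightarrow> ('a::euclidean_space \<Rightarrow> real) \<Rightarrow> 'a set \<Rightarrow> bool" where
  "holder_loc 0 \<gamma> u S \<longleftrightarrow>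
     continuous_on S u \<and>
     (\<forall>K\<subseteq>S. compact K \<longrightarrow>
        (\<exists>C. \<forall>x\<in>K. \<forall>y\<in>K. \<bar>u x - u y\<bar> \<le> C * dist x y powr \<gamma>))"
| "holder_loc (Suc k) \<gamma> u S \<longleftrightarrow>
     (\<forall>x\<in>S. u differentiable (at x)) \<and>
     (\<forall>b\<in>Basis. holder_loc k \<gamma> (\<lambda>x. frechet_derivative u (at x) b) S)"

definition C_loc :: "real \<Rightarrow> ('a::euclidean_space \<Rightarrow> real) \<Rightarrow> 'a set \<Rightarrow> bool" where
  "C_loc \<alpha> u S \<longleftrightarrow> holder_loc (nat \<lfloor>\<alpha>\<rfloor>) (frac \<alpha>) u S"

definition bounded_classical_solution ::
    "real \<Rightarrow> real \<Rightarrow> (real \<Rightarrow> real) \<Rightarrow> ((real^'m::finite) \<times> real \<Rightarrow> real) \<Rightarrow> bool" where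
  "bounded_classical_solution s \<beta> f u \<longleftrightarrow>
     bounded (range u) \<and>
     continuous_on UNIV u \<and>
     C_loc (2 * s + \<beta>) u upper_half_space \<and>
     (\<forall>x\<in>upper_half_space. has_fractional_laplacian s u x (f (u x))) \<and>
     (\<forall>x. x \<notin> upper_half_space \<longrightarrow> u x = 0)"

end

theory Submission
  imports Defs
begin

text \<open>
  Let \<open>w y = u (R y) - u y\<close>, where \<open>R\<close> is the reflection in \<open>{x\<^sub>N = lam}\<close>. It vanishes in
  the strip, is nonnegative below and nonpositive above it, and has fractional Laplacian \<open>0\<close> at
  every point of the strip. Off its support the fractional Laplacian is just minus the convolution
  with the kernel; comparing it at two mirror points \<open>p\<close>, \<open>R p\<close> of the strip,
  the difference of the kernels has the sign of \<open>w\<close>, so \<open>w = 0\<close>. Hence \<open>u\<close> vanishes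
  above the strip, where its fractional Laplacian is therefore constantly \<open>f 0\<close>. The same
  comparison at two points above the strip, one further away than the other, gives \<open>u = 0\<close>.
\<close>

lemma has_fractional_laplacian_diff:
  assumes "has_fractional_laplacian s u x L" and "has_fractional_laplacian s v x M"
  shows "has_fractional_laplacian s (\<lambda>y. u y - v y) x (L - M)"
proof -
  let ?k = "\<lambda>y. norm (x - y) powr (real DIM('a) + 2 * s)"
  let ?q = "\<lambda>u y. (u x - u y) / ?k y"
  let ?I = "\<lambda>u \<epsilon>. LINT y:- ball x \<epsilon>|lebesgue. ?q u y"
  have q: "?q (\<lambda>y. u y - v y) = (\<lambda>y. ?q u y - ?q v y)"
    by (simp add: diff_divide_distrib[symmetric] algebra_simps)
  have int: "set_integrable lebesgue (- ball x \<epsilon>) (?q u)"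
    "set_integrable lebesgue (- ball x \<epsilon>) (?q v)" if "\<epsilon> > 0" for \<epsilon>
    using assms that by (auto simp: has_fractional_laplacian_def)
  have "((\<lambda>\<epsilon>. ?I u \<epsilon> - ?I v \<epsilon>) \<longlongrightarrow> L - M) (at_right 0)"
    using assms by (intro tendsto_diff) (auto simp: has_fractional_laplacian_def)
  moreover have "eventually (\<lambda>\<epsilon>. ?I u \<epsilon> - ?I v \<epsilon> = ?I (\<lambda>y. u y - v y) \<epsilon>) (at_right 0)"
    using eventually_at_right_less[of 0]
    by eventually_elim (unfold q, simp add: set_integral_diff(2) int)
  ultimately have "((?I (\<lambda>y. u y - v y)) \<longlongrightarrow> L - M) (at_right 0)"
    using tendsto_cong by fast
  moreover have "set_integrable lebesgue (- ball x \<epsilon>) (?q (\<lambda>y. u y - v y))" if "\<epsilon> > 0" for \<epsilon>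
    unfolding q using int[OF that] by (rule set_integral_diff(1))
  ultimately show ?thesis
    by (simp add: has_fractional_laplacian_def)
qed

text \<open>The preimage of a ball around \<open>R x\<close> is the ball of the same radius around
  \<open>x\<close>, and the kernel depends on distances only. So the truncated integrals for
  \<open>u\<close> at \<open>R x\<close> and for \<open>u\<close> composed with \<open>R\<close> at
  \<open>x\<close> agree for each \<epsilon>, before any limit is taken.\<close>

lemma has_fractional_laplacian_isometry:
  fixes R :: "'a::euclidean_space \<Rightarrow> 'a"
  assumes iso: "\<And>y z. dist (R y) (R z) = dist y z"
    and meas: "R \<in> lebesgue \<rightarrow>\<^sub>M lebesgue" and distr: "distr lebesgue lebesgue R = lebesgue"
    and lap: "has_fractional_laplacian s u (R x) L"
  shows "has_fractional_laplacian s (\<lambda>y. u (R y)) x L"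
proof -
  let ?q = "\<lambda>u x y. (u x - u y) / norm (x - y) powr (real DIM('a) + 2 * s) :: real"
  define F where "F \<epsilon> y = indicator (- ball (R x) \<epsilon>) y *\<^sub>R ?q u (R x) y" for \<epsilon> y
  have F: "F \<epsilon> (R y) = indicator (- ball x \<epsilon>) y *\<^sub>R ?q (\<lambda>y. u (R y)) x y" for \<epsilon> y
    using iso[of x y] by (simp add: F_def indicator_def dist_norm)
  have int: "integrable lebesgue (F \<epsilon>)" if "\<epsilon> > 0" for \<epsilon>
    using lap that by (simp add: has_fractional_laplacian_def set_integrable_def F_def[abs_def])
  then have int': "integrable lebesgue (\<lambda>y. F \<epsilon> (R y))" if "\<epsilon> > 0" for \<epsilon>
    using integrable_distr[OF meas] distr that by metis
  have eq: "(LINT y|lebesgue. F \<epsilon> (R y)) = (LINT y|lebesgue. F \<epsilon> y)" if "\<epsilon> > 0" for \<epsilon>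
    using integral_distr[OF meas borel_measurable_integrable[OF int[OF that]]] distr by simp
  have "((\<lambda>\<epsilon>. LINT y|lebesgue. F \<epsilon> y) \<longlongrightarrow> L) (at_right 0)"
    using lap by (simp add: has_fractional_laplacian_def set_lebesgue_integral_def F_def)
  moreover have "eventually (\<lambda>\<epsilon>. (LINT y|lebesgue. F \<epsilon> y) = (LINT y|lebesgue. F \<epsilon> (R y))) (at_right 0)"
    using eventually_at_right_less[of 0] by eventually_elim (simp add: eq)
  ultimately have "((\<lambda>\<epsilon>. LINT y|lebesgue. F \<epsilon> (R y)) \<longlongrightarrow> L) (at_right 0)"
    using tendsto_cong by fast
  with int' show ?thesis
    by (simp add: has_fractional_laplacian_def set_integrable_def set_lebesgue_integral_def F)
qed

text \<open>The integrand vanishes near \<open>x\<close>, so the truncated integrals are constant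
  for small \<epsilon> and the principal value is an ordinary integral. The minus sign comes from
  \<open>g x - g y = - g y\<close>.\<close>

lemma has_fractional_laplacian_off_support:
  fixes g :: "'a::euclidean_space \<Rightarrow> real"
  assumes "has_fractional_laplacian s g x L" and "r > 0" and "\<And>y. y \<in> ball x r \<Longrightarrow> g y = 0"
  shows "has_bochner_integral lebesgue
    (\<lambda>y. g y / norm (x - y) powr (real DIM('a) + 2 * s)) (- L)"
proof -
  let ?k = "\<lambda>y. norm (x - y) powr (real DIM('a) + 2 * s)"
  have F: "indicator (- ball x \<epsilon>) y *\<^sub>R ((g x - g y) / ?k y) = - (g y / ?k y)"
    if "0 < \<epsilon>" "\<epsilon> \<le> r" for \<epsilon> y
    using assms(2,3) that by (auto simp: indicator_def)
  have "set_integrable lebesgue (- ball x r) (\<lambda>y. (g x - g y) / ?k y)"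
    using assms(1) \<open>r > 0\<close> by (simp add: has_fractional_laplacian_def)
  then have int: "integrable lebesgue (\<lambda>y. - (g y / ?k y))"
    unfolding set_integrable_def F[OF \<open>r > 0\<close> order_refl] .
  have "eventually (\<lambda>\<epsilon>. (LINT y:- ball x \<epsilon>|lebesgue. (g x - g y) / ?k y)
      = (LINT y|lebesgue. - (g y / ?k y))) (at_right 0)"
    using eventually_at_right_real[OF \<open>r > 0\<close>]
    by eventually_elim (simp only: set_lebesgue_integral_def F greaterThanLessThan_iff less_imp_le)
  then have "((\<lambda>\<epsilon>. LINT y:- ball x \<epsilon>|lebesgue. (g x - g y) / ?k y) \<longlongrightarrow>
      (LINT y|lebesgue. - (g y / ?k y))) (at_right 0)"
    by (rule tendsto_eventually)
  moreover have "((\<lambda>\<epsilon>. LINT y:- ball x \<epsilon>|lebesgue. (g x - g y) / ?k y) \<longlongrightarrow> L) (at_right 0)"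
    using assms(1) by (simp add: has_fractional_laplacian_def)
  ultimately have "(LINT y|lebesgue. - (g y / ?k y)) = L"
    using tendsto_unique trivial_limit_at_right_real by blast
  with int have "has_bochner_integral lebesgue (\<lambda>y. - (g y / ?k y)) L"
    by (simp add: has_bochner_integral_iff)
  from has_bochner_integral_minus[OF this] show ?thesis by simp
qed

lemma continuous_AE_zero_imp_zero:
  fixes g :: "'a::euclidean_space \<Rightarrow> real"
  assumes "continuous_on UNIV g" and "AE y in lebesgue. g y = 0"
  shows "g y = 0"
proof -
  have "open {y. g y \<noteq> 0}"
    using assms(1) by (intro open_Collect_neq) auto
  moreover obtain N where "N \<in> null_sets lebesgue" "{y. g y \<noteq> 0} \<subseteq> N"
    using assms(2) by (auto simp: eventually_ae_filter)
  then have "negligible {y. g y \<noteq> 0}"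
    by (metis negligible_iff_null_sets negligible_subset)
  ultimately show ?thesis
    using open_not_negligible by blast
qed

text \<open>The integral representations at \<open>p\<close> and \<open>q\<close> have the same
  value, so their difference integrates to 0. The kernel decreases strictly with distance, so by
  \<open>pos\<close> and \<open>neg\<close> the kernel difference has the sign of \<open>g\<close>.
  The integrand is then nonnegative, and positive wherever \<open>g\<close> is nonzero.\<close>

lemma equal_fractional_laplacians_imp_zero:
  fixes g :: "'a::euclidean_space \<Rightarrow> real"
  assumes "0 < s" and cont: "continuous_on UNIV g" and "r > 0"
    and "has_fractional_laplacian s g p L" and p: "\<And>y. y \<in> ball p r \<Longrightarrow> g y = 0"
    and "has_fractional_laplacian s g q L" and q: "\<And>y. y \<in> ball q r \<Longrightarrow> g y = 0"
    and pos: "\<And>y. g y > 0 \<Longrightarrow> dist p y < dist q y"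
    and neg: "\<And>y. g y < 0 \<Longrightarrow> dist q y < dist p y"
  shows "g y = 0"
proof (rule continuous_AE_zero_imp_zero[OF cont])
  let ?d = "real DIM('a) + 2 * s"
  let ?h = "\<lambda>y. g y / norm (p - y) powr ?d - g y / norm (q - y) powr ?d"
  have d: "?d > 0" using \<open>0 < s\<close> by simp
  have "g p = 0" "g q = 0"
    using p[of p] q[of q] \<open>r > 0\<close> by auto
  \<comment> \<open>This keeps \<open>y\<close> away from the poles of the two kernels, where
    division by zero would yield 0 rather than infinity.\<close>
  then have ne: "0 < norm (p - y)" "0 < norm (q - y)" if "g y \<noteq> 0" for y
    using that by auto
  have h_pos: "?h y > 0" if "g y \<noteq> 0" for y
  proof (cases "g y > 0")
    case True
    then have "norm (p - y) powr ?d < norm (q - y) powr ?d"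
      using pos[of y] d by (intro powr_less_mono2) (auto simp: dist_norm)
    then show ?thesis
      using True ne[OF that] by (simp add: divide_strict_left_mono)
  next
    case False
    then have "norm (q - y) powr ?d < norm (p - y) powr ?d"
      using that neg[of y] d by (intro powr_less_mono2) (auto simp: dist_norm)
    then show ?thesis
      using False that ne[OF that] by (simp add: divide_strict_left_mono_neg)
  qed
  have "has_bochner_integral lebesgue ?h (- L - - L)"
    by (intro has_bochner_integral_diff has_fractional_laplacian_off_support[of _ _ _ _ r] assms)
  moreover have "0 \<le> ?h y" for y
    using h_pos[of y] by (cases "g y = 0") auto
  ultimately have "AE y in lebesgue. ?h y = 0"
    using integral_nonneg_eq_0_iff_AE[of lebesgue ?h] by (simp add: has_bochner_integral_iff)
  then show "AE y in lebesgue. g y = 0"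
    by eventually_elim (use h_pos in force)
qed

text \<open>The reflection is affine and diagonal in the standard basis, with entry -1 along
  \<open>(0, 1)\<close> and 1 elsewhere. The modulus of its determinant is 1, so Lebesgue measure is
  preserved.\<close>

lemma lebesgue_reflect_snd:
  fixes c :: real
  defines "R \<equiv> \<lambda>y :: 'a::euclidean_space \<times> real. (fst y, c - snd y)"
  shows "R \<in> lebesgue \<rightarrow>\<^sub>M lebesgue" and "distr lebesgue lebesgue R = lebesgue"
proof -
  define e where "e j = (if j = (0, 1) then - 1 else 1 :: real)" for j :: "'a \<times> real"
  define t :: "'a \<times> real" where "t = (0, c)"
  have e: "e j \<noteq> 0" for j by (simp add: e_def)
  have one: "(0 :: 'a, 1 :: real) \<in> Basis" by (simp add: Basis_prod_def)
  have R: "R = (\<lambda>y. t + (\<Sum>j\<in>Basis. (e j * (y \<bullet> j)) *\<^sub>R j))"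
  proof
    fix y :: "'a \<times> real"
    have "(\<Sum>j\<in>Basis. (e j * (y \<bullet> j)) *\<^sub>R j)
        = (\<Sum>j\<in>Basis. (y \<bullet> j) *\<^sub>R j - (if j = (0, 1) then (2 * snd y) *\<^sub>R (0, 1) else 0))"
      by (intro sum.cong) (auto simp: e_def inner_prod_def)
    also have "\<dots> = y - (2 * snd y) *\<^sub>R (0, 1)"
      using one by (simp add: sum_subtractf euclidean_representation)
    finally show "R y = t + (\<Sum>j\<in>Basis. (e j * (y \<bullet> j)) *\<^sub>R j)"
      by (simp add: R_def t_def prod_eq_iff)
  qed
  show "R \<in> lebesgue \<rightarrow>\<^sub>M lebesgue"
    unfolding R by (rule lebesgue_affine_measurable) (rule e)
  have "(\<Prod>j\<in>Basis. \<bar>e j\<bar>) = 1"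
    by (intro prod.neutral) (auto simp: e_def)
  then show "distr lebesgue lebesgue R = lebesgue"
    using lebesgue_affine_euclidean[of e t, OF e] by (simp add: R density_1)
qed

theorem theorem8:
  fixes s \<beta> lam :: real
    and f :: "real \<Rightarrow> real"
    and u :: "(real^'m::finite) \<times> real \<Rightarrow> real"
  assumes "0 < s" and "s < 1"
    and "isCont f 0"
    and "0 < \<beta>" and "\<beta> < 1"
    and "bounded_classical_solution s \<beta> f u"
    and "\<And>x. 0 \<le> u x"
    and "0 < lam"
    and "\<And>x' t. (x', t) \<in> strip (2 * lam) \<Longrightarrow> u (x', 2 * lam - t) = u (x', t)"
  shows "f 0 = 0 \<and> (\<forall>x. u x = 0)"
proof -
  note nonneg = \<open>\<And>x. 0 \<le> u x\<close>
  define R where "R y = (fst y, 2 * lam - snd y)" for y :: "(real^'m) \<times> real"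
  have cont: "continuous_on UNIV u"
    and lap: "\<And>x. 0 < snd x \<Longrightarrow> has_fractional_laplacian s u x (f (u x))"
    and zero: "\<And>x. snd x \<le> 0 \<Longrightarrow> u x = 0"
    using assms(6) by (auto simp: bounded_classical_solution_def upper_half_space_def not_less)
  have sym: "u (R y) = u y" if "0 < snd y" "snd y < 2 * lam" for y
    using assms(9)[of "fst y" "snd y"] that by (simp add: strip_def R_def)
  have isometry: "dist (R y) (R z) = dist y z" for y z
    by (simp add: R_def dist_prod_def dist_real_def abs_minus_commute)
  have measurable: "R \<in> lebesgue \<rightarrow>\<^sub>M lebesgue" and distr: "distr lebesgue lebesgue R = lebesgue"
    using lebesgue_reflect_snd[of "2 * lam"] by (simp_all add: R_def[abs_def])
  have snd_near: "snd x - r < snd y" "snd y < snd x + r" if "y \<in> ball x r" for x y :: "(real^'m) \<times> real" and r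
    using that dist_snd_le[of x y] by (simp_all add: dist_real_def)
  \<comment> \<open>Both reference points lie on the axis x' = 0, so the horizontal parts of the
    squared distances coincide and only heights matter.\<close>
  have closer: "dist (0, a) y < dist (0, b) y"
    if "\<bar>a - snd y\<bar> < \<bar>b - snd y\<bar>" for a b and y :: "(real^'m) \<times> real"
    using power_strict_mono[OF that, of 2] by (cases y) (simp add: dist_prod_def dist_real_def)
  \<comment> \<open>The points at heights \<open>lam / 2\<close> and \<open>3 * lam / 2\<close> are
    mirror images, and their balls of radius \<open>lam / 2\<close> stay inside the open
    strip.\<close>
  have "u (R y) - u y = 0" for y
  proof (rule equal_fractional_laplacians_imp_zero[where g = "\<lambda>y. u (R y) - u y" and L = 0
        and p = "(0, lam / 2)" and q = "(0, 3 * lam / 2)" and r = "lam / 2"])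
    show "continuous_on UNIV (\<lambda>y. u (R y) - u y)"
      unfolding R_def by (intro continuous_intros continuous_on_compose2[OF cont]) auto
    \<comment> \<open>By symmetry \<open>u\<close> takes the same value at \<open>x\<close> and
      \<open>R x\<close>, both in the half-space, so the two right-hand sides cancel for any
      \<open>f\<close>.\<close>
    have "has_fractional_laplacian s (\<lambda>y. u (R y) - u y) x 0"
      if "0 < snd x" "snd x < 2 * lam" for x
    proof -
      have "has_fractional_laplacian s u (R x) (f (u x))"
        using lap[of "R x"] sym[OF that] that by (simp add: R_def)
      then have "has_fractional_laplacian s (\<lambda>y. u (R y)) x (f (u x))"
        by (intro has_fractional_laplacian_isometry[where R = R and u = u] isometry measurable distr)
      from has_fractional_laplacian_diff[OF this lap[OF that(1)]] show ?thesis by simp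
    qed
    then show "has_fractional_laplacian s (\<lambda>y. u (R y) - u y) (0, lam / 2) 0"
      "has_fractional_laplacian s (\<lambda>y. u (R y) - u y) (0, 3 * lam / 2) 0"
      using \<open>0 < lam\<close> by simp_all
    show "u (R y) - u y = 0" if "y \<in> ball (0, lam / 2) (lam / 2)" for y
      using snd_near[OF that] sym[of y] \<open>0 < lam\<close> by simp
    show "u (R y) - u y = 0" if "y \<in> ball (0, 3 * lam / 2) (lam / 2)" for y
      using snd_near[OF that] sym[of y] \<open>0 < lam\<close> by simp
    show "dist (0, lam / 2) y < dist (0, 3 * lam / 2) y" if "u (R y) - u y > 0" for y
    proof -
      \<comment> \<open>Here \<open>u (R y)\<close> is positive, so \<open>R y\<close> lies in the
        half-space. Symmetry then excludes the strip itself, which leaves only points below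
        it.\<close>
      have "snd y < 2 * lam"
        using that zero[of "R y"] nonneg[of y] by (force simp: R_def)
      then have "snd y \<le> 0"
        using that sym[of y] by force
      then show ?thesis
        using \<open>0 < lam\<close> by (intro closer) simp
    qed
    show "dist (0, 3 * lam / 2) y < dist (0, lam / 2) y" if "u (R y) - u y < 0" for y
    proof -
      have "0 < snd y"
        using that zero[of y] nonneg[of "R y"] by force
      then have "2 * lam \<le> snd y"
        using that sym[of y] by force
      then show ?thesis
        using \<open>0 < lam\<close> by (intro closer) simp
    qed
  qed (use assms in auto)
  \<comment> \<open>Reflection sends such a point to height at most 0, where \<open>u\<close>
    vanishes.\<close>
  then have above: "u y = 0" if "2 * lam \<le> snd y" for y
    using zero[of "R y"] that by (simp add: R_def)
  have lap0: "has_fractional_laplacian s u x (f 0)" if "2 * lam \<le> snd x" for x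
    using lap[of x] above[OF that] that \<open>0 < lam\<close> by simp
  have near: "u y = 0" if "y \<in> ball x lam" "3 * lam \<le> snd x" for x y
    using snd_near(1)[OF that(1)] that(2) by (intro above) linarith
  \<comment> \<open>Heights \<open>3 * lam\<close> and \<open>4 * lam\<close> leave room for balls
    of radius \<open>lam\<close> above level \<open>2 * lam\<close>. Every point where
    \<open>u\<close> is positive lies below that level, hence nearer to the lower center.\<close>
  have u0: "u y = 0" for y
  proof (rule equal_fractional_laplacians_imp_zero[where g = u and L = "f 0"
        and p = "(0, 3 * lam)" and q = "(0, 4 * lam)" and r = lam])
    show "dist (0, 3 * lam) y < dist (0, 4 * lam) y" if "u y > 0" for y
    proof -
      have "snd y < 2 * lam"
        using that above[of y] by force
      then show ?thesis
        using \<open>0 < lam\<close> by (intro closer) simp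
    qed
    show "dist (0, 4 * lam) y < dist (0, 3 * lam) y" if "u y < 0" for y
      using that nonneg[of y] by simp
  qed (use assms cont near in \<open>auto intro!: lap0\<close>)
  \<comment> \<open>Now that \<open>u\<close> vanishes identically, its fractional Laplacian, known
    to be \<open>f 0\<close> at height \<open>2 * lam\<close>, is minus the integral of the zero
    function.\<close>
  have "has_bochner_integral lebesgue (\<lambda>y :: (real^'m) \<times> real. 0 :: real) (- f 0)"
    using has_fractional_laplacian_off_support[OF lap0[of "(0, 2 * lam)"] \<open>0 < lam\<close>] u0 by simp
  then have "f 0 = 0"
    by (simp add: has_bochner_integral_iff)
  with u0 show ?thesis by simp
qed

end
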